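(* Let $n,k\ge2$, let $\mathbb{Z}^n$ and $\mathbb{Z}^k$ be the free abelian groups of ranks $n$ and $k$, and let $1\le p\le\infty$. With respect to the lengths on $\mathbb{Z}^n$ and $\mathbb{Z}^k$ given by the restrictions $l_p$ of the $\|\cdot\|_p$-norms, the following inequalities hold: $$\frac1{\zeta(n)}\le\liminf_{s\to\infty,\,t\to\infty}e_\rho(\mathbb{Z}^n,\mathbb{Z}^k,s,t),$$ $$\limsup_{s\to\infty,\,t\to\infty}e_\rho(\mathbb{Z}^n,\mathbb{Z}^k,s,t)\le1-\frac1{\zeta(k)}\left(1-\frac1{\zeta(n)}\right).$$
   Context: For $1\le p\le\infty$, $l_p\colon\mathbb{Z}^r\to\mathbb{R}$ denotes the restriction to $\mathbb{Z}^r$ of the $\|\cdot\|_p$-norm on $\mathbb{R}^r$. For groups $F,G$ with length functions $l_F,l_G$, the $(s,t)$-mapping ratio is $$e_\rho(F,G,s,t)=\frac{\#\{(f,g)\in F\times G: l_F(f)\le s,\ l_G(g)\le t,\ \phi(f)=g\text{ for some }\phi\in\mathrm{Hom}(F,G)\}}{\#\{(f,g)\in F\times G: l_F(f)\le s,\ l_G(g)\le t\}}.$$ The liminf and limsup are over pairs of positive integers $(s,t)$ as both tend to infinity. $\zeta$ is the Riemann zeta function. *)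

theory Defs
  imports "HOL-Analysis.Analysis" "HOL-Algebra.Group"
begin

definition free_abelian :: "(int ^ 'n) monoid" where
  "free_abelian = \<lparr>carrier = UNIV, monoid.mult = (+), one = 0\<rparr>"

lemma comm_group_free_abelian: "comm_group free_abelian"
  by (rule comm_groupI) (auto simp: free_abelian_def ac_simps intro: exI[of _ "- x" for x])

definition lp_norm :: "ereal \<Rightarrow> real ^ 'n \<Rightarrow> real" where
  "lp_norm p x =
    (if p = \<infinity> then infnorm x
     else (\<Sum>i\<in>UNIV. \<bar>x $ i\<bar> powr real_of_ereal p) powr (1 / real_of_ereal p))"

definition lp_length :: "ereal \<Rightarrow> int ^ 'n \<Rightarrow> real" where
  "lp_length p x = lp_norm p (\<chi> i. real_of_int (x $ i))"

text \<open>Cardinalities are natural numbers, with value 0 for infinite sets; the ratio is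
  meaningful for length functions whose balls are finite, such as \<^const>\<open>lp_length\<close>
  for exponents at least 1.\<close>

definition mapping_ratio ::
  "('a, 'c) monoid_scheme \<Rightarrow> ('b, 'd) monoid_scheme \<Rightarrow> ('a \<Rightarrow> real) \<Rightarrow> ('b \<Rightarrow> real)
    \<Rightarrow> nat \<Rightarrow> nat \<Rightarrow> real" where
  "mapping_ratio F G lF lG s t =
    real (card {(f, g) \<in> carrier F \<times> carrier G.
                  lF f \<le> real s \<and> lG g \<le> real t \<and> (\<exists>\<phi>\<in>hom F G. \<phi> f = g)})
    / real (card {(f, g) \<in> carrier F \<times> carrier G. lF f \<le> real s \<and> lG g \<le> real t})"

text \<open>The Riemann zeta function on the real half-line \<open>x > 1\<close>, where its Dirichlet
  series converges; the index is shifted so that the series starts at 1.\<close>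

definition zeta :: "real \<Rightarrow> real" where
  "zeta x = (\<Sum>m. 1 / real (Suc m) powr x)"

end

theory Submission
  imports Defs
begin

text \<open>A homomorphism takes a primitive \<open>f\<close> (one whose coordinates generate the unit ideal) to any
  prescribed \<open>g\<close>, while a primitive \<open>g\<close> is the image of primitive vectors only. So if \<open>\<delta>\<close> and \<open>\<epsilon>\<close>
  are the proportions of primitive vectors in the two balls, the mapping ratio lies between \<open>\<delta>\<close>
  and \<open>1 - \<epsilon> (1 - \<delta>)\<close>, and it remains to see that these proportions tend to \<open>1 / \<zeta>(n)\<close> and
  \<open>1 / \<zeta>(k)\<close>.

  Let \<open>b(s)\<close> be the number of nonzero lattice points in the ball of radius \<open>s\<close>, divided by \<open>s^n\<close>,
  and \<open>a(s)\<close> the same quotient for primitive points. Writing each nonzero point as a positive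
  integer times a primitive one gives \<open>b(s) = \<Sum>d\<ge>1. a(s/d) / d^n\<close>. Here \<open>b(s)\<close> tends to the volume
  \<open>V\<close> of the unit ball, and instead of Moebius inversion one can use \<open>\<zeta>(n) < 2\<close>: the difference
  \<open>u = a - V / \<zeta>(n)\<close> satisfies \<open>u(s) = b(s) - V - (\<Sum>d\<ge>2. u(s/d) / d^n)\<close> with total weight
  \<open>\<zeta>(n) - 1 < 1\<close>, which forces \<open>u(s)\<close> to tend to 0.\<close>

section \<open>Analytic preliminaries: the zeta series and a contraction principle\<close>

lemma zeta_nat: "zeta (real n) = (\<Sum>m. 1 / real (Suc m) ^ n)"
  by (simp add: zeta_def powr_realpow del: of_nat_Suc)

lemma summable_zeta:
  assumes "n \<ge> 2"
  shows "summable (\<lambda>m. 1 / real (Suc m) ^ n)"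
  using inverse_power_summable[OF assms, where 'a = real]
  by (subst (asm) summable_Suc_iff[symmetric]) (simp add: inverse_eq_divide)

text \<open>The index \<open>k\<close> stands for the divisor d = k + 2, so these are the weights of
  the divisors d \<ge> 2 in the recursion for the primitive count.\<close>

lemma zeta_tail:
  assumes "n \<ge> 2"
  shows "(\<lambda>k. 1 / real (k + 2) ^ n) sums (zeta (real n) - 1)"
proof -
  have "(\<lambda>m. 1 / real (Suc m) ^ n) sums zeta (real n)"
    unfolding zeta_nat using summable_zeta[OF assms] by (rule summable_sums)
  then show ?thesis
    by (auto dest: sums_split_initial_segment[where n = 1])
qed

text \<open>Termwise comparison with exponent 2 reduces this to the Basel value pi^2/6 < 2. The
  bound keeps the total weight zeta(n) - 1 below 1, as the contraction requires.\<close>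

lemma zeta_nat_less_2:
  assumes "n \<ge> 2"
  shows "zeta (real n) < 2"
proof -
  have s2: "(\<lambda>m. 1 / real (Suc m) ^ 2) sums (pi\<^sup>2 / 6)"
    using inverse_squares_sums by (simp add: add.commute)
  have "zeta (real n) \<le> (\<Sum>m. 1 / real (Suc m) ^ 2)"
    unfolding zeta_nat
    using summable_zeta[OF assms] summable_zeta[of 2] assms
    by (intro suminf_le) (auto intro!: divide_left_mono power_increasing simp del: of_nat_Suc)
  also have "\<dots> = pi\<^sup>2 / 6" using s2 by (simp add: sums_iff)
  also have "\<dots> < 2"
  proof -
    have "pi\<^sup>2 \<le> (3.2::real)\<^sup>2"
      using pi_approx pi_gt_zero by (intro power_mono) auto
    then show ?thesis by (simp add: power2_eq_square)
  qed
  finally show ?thesis .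
qed

lemma zeta_nat_ge_1:
  assumes "n \<ge> 2"
  shows "1 \<le> zeta (real n)"
proof -
  have "0 \<le> zeta (real n) - 1"
    using zeta_tail[OF assms] by (rule sums_le[OF _ sums_zero, rotated]) auto
  then show ?thesis by simp
qed

text \<open>The hypothesis says that \<open>\<bar>u\<bar>\<close> is, up to \<open>h\<close>, bounded by an average of its earlier
  values with total weight below 1; each application improves an eventual bound on \<open>\<bar>u\<bar>\<close>
  by the factor \<open>\<Sum>k. w k\<close>.\<close>

lemma tendsto_0_of_contraction:
  fixes u h :: "real \<Rightarrow> real" and w :: "nat \<Rightarrow> real"
  assumes w: "\<And>k. 0 \<le> w k" "summable w" "suminf w < 1"
    and bound: "\<And>s. 0 < s \<Longrightarrow> \<bar>u s\<bar> \<le> K"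
    and h: "(h \<longlongrightarrow> 0) at_top"
    and step: "\<And>s. 0 < s \<Longrightarrow> \<bar>u s\<bar> \<le> h s + (\<Sum>k. w k * \<bar>u (s / real (k + 2))\<bar>)"
  shows "(u \<longlongrightarrow> 0) at_top"
proof -
  define c where "c = suminf w"
  have c: "0 \<le> c" "c < 1" using w by (auto simp: c_def suminf_nonneg)
  have K: "0 \<le> K" using bound[of 1] by linarith
  have sm: "summable (\<lambda>k. w k * \<bar>u (s / real (k + 2))\<bar>)" if "0 < s" for s
    by (rule summable_comparison_test[of _ "\<lambda>k. w k * K"])
       (use w bound[of "s / real (k + 2)" for k] that in
        \<open>auto intro!: exI[of _ 0] mult_left_mono summable_mult2 simp: abs_mult\<close>)
  \<comment> \<open>Each induction step loses an arbitrarily small amount, so the slack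
    \<open>e\<close> is kept general and redistributed at every step.\<close>
  have ev: "\<forall>\<^sub>F s in at_top. \<bar>u s\<bar> \<le> c ^ j * K + e" if "0 < e" for j e
    using that
  proof (induction j arbitrary: e)
    case 0
    show ?case
      using eventually_gt_at_top[of 0]
      by eventually_elim (use bound 0 in fastforce)
  next
    case (Suc j)
    \<comment> \<open>One quarter of the slack goes to the induction hypothesis, one to the tail of
      the series and one to \<open>h\<close>.\<close>
    define M where "M = c ^ j * K + e / 4"
    have M0: "0 \<le> M" using c K Suc.prems by (simp add: M_def)
    have "\<forall>\<^sub>F s in at_top. \<bar>u s\<bar> \<le> M"
      unfolding M_def using Suc.prems by (intro Suc.IH) auto
    then obtain S where S: "\<And>s. s \<ge> S \<Longrightarrow> \<bar>u s\<bar> \<le> M"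
      by (auto simp: eventually_at_top_linorder)
    \<comment> \<open>\<open>c - sum w {..<m}\<close> is the weight of the tail from
      \<open>m\<close> on. There only the global bound \<open>K\<close> is available, so
      \<open>m\<close> is chosen to make the tail negligible.\<close>
    have "(\<lambda>m. (c - sum w {..<m}) * K) \<longlonglongrightarrow> (c - c) * K"
      unfolding c_def using summable_LIMSEQ[OF w(2)] by (intro tendsto_intros)
    then have "\<forall>\<^sub>F m in sequentially. (c - sum w {..<m}) * K < e / 4"
      using Suc.prems by (intro order_tendstoD) auto
    then obtain m where m: "(c - sum w {..<m}) * K < e / 4"
      by (auto simp: eventually_sequentially)
    have "\<forall>\<^sub>F s in at_top. h s < e / 4"
      using h Suc.prems by (intro order_tendstoD) auto
    then show ?case
      \<comment> \<open>Beyond this threshold all arguments \<open>s / real (k + 2)\<close> with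
        \<open>k < m\<close> exceed \<open>S\<close>. The maximum with 1 keeps the threshold
        increasing in \<open>m\<close> even if \<open>S\<close> is negative.\<close>
      using eventually_ge_at_top[of "max 1 (real (m + 2) * max S 1)"]
    proof eventually_elim
      case (elim s)
      then have s0: "0 < s" and sS: "real (m + 2) * max S 1 \<le> s" by auto
      have term_le: "w k * \<bar>u (s / real (k + 2))\<bar> \<le> w k * M" if "k < m" for k
      proof -
        have "real (k + 2) * max S 1 \<le> real (m + 2) * max S 1"
          using that by (intro mult_right_mono) auto
        then have "S \<le> s / real (k + 2)"
          using sS order_trans[of "real (k + 2) * S" "real (k + 2) * max S 1" s]
          by (simp add: pos_le_divide_eq mult.commute mult_left_mono)
        then show ?thesis using w S by (intro mult_left_mono) auto
      qed
      have "(\<Sum>k. w k * \<bar>u (s / real (k + 2))\<bar>)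
          = (\<Sum>k. w (k + m) * \<bar>u (s / real (k + m + 2))\<bar>)
            + (\<Sum>k<m. w k * \<bar>u (s / real (k + 2))\<bar>)"
        using suminf_split_initial_segment[OF sm[OF s0], of m] by simp
      also have "\<dots> \<le> (c - sum w {..<m}) * K + c * M"
      proof (intro add_mono)
        have "(\<Sum>k. w (k + m) * \<bar>u (s / real (k + m + 2))\<bar>) \<le> (\<Sum>k. w (k + m) * K)"
          using sm[OF s0] w s0 
          by (intro suminf_le mult_left_mono bound summable_mult2)
             (auto simp: summable_iff_shift[of "\<lambda>k. w k * \<bar>u (s / real (k + 2))\<bar>" m, simplified])
        also have "\<dots> = (c - sum w {..<m}) * K"
          unfolding c_def using w suminf_split_initial_segment[OF w(2), of m]
          by (subst suminf_mult2[symmetric]) auto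
        finally show "(\<Sum>k. w (k + m) * \<bar>u (s / real (k + m + 2))\<bar>) \<le> (c - sum w {..<m}) * K" .
        have "(\<Sum>k<m. w k * \<bar>u (s / real (k + 2))\<bar>) \<le> (\<Sum>k<m. w k * M)"
          by (intro sum_mono term_le) auto
        also have "\<dots> \<le> c * M"
          unfolding c_def sum_distrib_right[symmetric]
          using w M0 by (intro mult_right_mono sum_le_suminf) auto
        finally show "(\<Sum>k<m. w k * \<bar>u (s / real (k + 2))\<bar>) \<le> c * M" .
      qed
      finally have "\<bar>u s\<bar> \<le> h s + ((c - sum w {..<m}) * K + c * M)"
        using step[OF s0] by linarith
      also have "\<dots> \<le> e / 4 + (e / 4 + c * M)" using elim m by linarith
      also have "c * M \<le> c ^ Suc j * K + e / 4"
        using c Suc.prems mult_right_mono[of c 1 "e / 4"] by (simp add: M_def algebra_simps)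
      finally show ?case using Suc.prems by simp
    qed
  qed
  show ?thesis
  proof (rule tendstoI)
    fix e :: real assume e: "0 < e"
    have "(\<lambda>j. c ^ j * K) \<longlonglongrightarrow> 0 * K"
      using c by (intro tendsto_intros LIMSEQ_realpow_zero) auto
    then have "\<forall>\<^sub>F j in sequentially. c ^ j * K < e / 2"
      using e by (intro order_tendstoD) auto
    then obtain j where j: "c ^ j * K < e / 2" by (auto simp: eventually_sequentially)
    show "\<forall>\<^sub>F s in at_top. dist (u s) 0 < e"
      using ev[of "e / 2" j] e j by (auto elim!: eventually_mono)
  qed
qed

section \<open>Primitive integer vectors and homomorphisms between free abelian groups\<close>

text \<open>The Bezout form of gcd 1: the coefficients \<open>c\<close> give a linear functional
  with value 1 at \<open>x\<close>, from which both homomorphisms and divisibility facts are read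
  off.\<close>

definition primitive :: "int ^ 'n \<Rightarrow> bool" where
  "primitive x \<longleftrightarrow> (\<exists>c. (\<Sum>i\<in>UNIV. c i * x $ i) = 1)"

lemma not_primitive_0: "\<not> primitive 0"
  by (simp add: primitive_def)

text \<open>Take for \<open>d\<close> the least positive integer combination of the coordinates. It
  divides each coordinate, since a nonzero remainder would be a smaller combination, and cancelling
  \<open>d\<close> in its Bezout identity shows that the quotient vector is primitive.\<close>

lemma primitive_decomposition:
  fixes x :: "int ^ 'n"
  assumes "x \<noteq> 0"
  obtains d y where "0 < d" "primitive y" "x = int d *s y"
proof -
  \<comment> \<open>\<open>Q m\<close> says that \<open>m\<close> is a positive element of the ideal
    generated by the coordinates; a nonzero coordinate, up to sign, is one.\<close>
  define Q where "Q m \<longleftrightarrow> 0 < m \<and> (\<exists>c. (\<Sum>i\<in>UNIV. c i * x $ i) = int m)" for m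
  obtain j where j: "x $ j \<noteq> 0" using assms by (auto simp: vec_eq_iff)
  have "(\<Sum>i\<in>UNIV. (if i = j then sgn (x $ j) else 0) * x $ i) = int (nat \<bar>x $ j\<bar>)"
    by (simp add: if_distrib[of "\<lambda>t. t * _"] abs_sgn[symmetric] mult.commute[of "sgn _"] cong: if_cong)
  then have "Q (nat \<bar>x $ j\<bar>)"
    unfolding Q_def using j by (auto intro!: exI[of _ "\<lambda>i. if i = j then sgn (x $ j) else 0"])
  define d where "d = (LEAST m. Q m)"
  have "Q d" unfolding d_def using \<open>Q (nat \<bar>x $ j\<bar>)\<close> by (rule LeastI)
  then obtain c where d: "0 < d" and c: "(\<Sum>i\<in>UNIV. c i * x $ i) = int d"
    by (auto simp: Q_def)
  have dvd: "int d dvd x $ k" for k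
  proof (rule ccontr)
    assume "\<not> int d dvd x $ k"
    define r where "r = x $ k mod int d"
    have r: "0 < r" "r < int d"
      using \<open>\<not> int d dvd x $ k\<close> d pos_mod_sign[of "int d" "x $ k"] pos_mod_bound[of "int d" "x $ k"]
      unfolding r_def dvd_eq_mod_eq_0 by linarith+
    have "(\<Sum>i\<in>UNIV. ((if i = k then 1 else 0) - x $ k div int d * c i) * x $ i)
        = x $ k - x $ k div int d * (\<Sum>i\<in>UNIV. c i * x $ i)"
      by (simp add: left_diff_distrib sum_subtractf sum_distrib_left mult.assoc
          if_distrib[of "\<lambda>t. t * _"] cong: if_cong)
    also have "\<dots> = int (nat r)"
      using r by (simp add: c r_def minus_div_mult_eq_mod)
    finally have "Q (nat r)" unfolding Q_def using r
      by (intro conjI exI[of _ "\<lambda>i. (if i = k then 1 else 0) - x $ k div int d * c i"]) auto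
    then have "d \<le> nat r" unfolding d_def by (rule Least_le)
    then show False using r by linarith
  qed
  define y where "y = (\<chi> i. x $ i div int d)"
  have x: "x = int d *s y"
    using dvd by (simp add: vec_eq_iff y_def)
  have "int d * (\<Sum>i\<in>UNIV. c i * y $ i) = int d * 1"
    using c by (subst (asm) x) (simp add: sum_distrib_left mult.left_commute)
  then have "primitive y"
    using d by (auto simp: primitive_def)
  with d x show thesis using that by blast
qed

text \<open>The Bezout functional of \<open>x\<close>, applied to both sides, gives \<open>a\<close>
  on the left and a multiple of \<open>b\<close> on the right.\<close>

lemma primitive_scale_dvd:
  fixes x y :: "int ^ 'n"
  assumes "primitive x" "a *s x = b *s y"
  shows "b dvd a"
proof -
  obtain c where "(\<Sum>i\<in>UNIV. c i * x $ i) = 1" using assms by (auto simp: primitive_def)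
  then have "a = (\<Sum>i\<in>UNIV. c i * (a *s x) $ i)"
    by (simp add: mult.left_commute[of _ a] flip: sum_distrib_left)
  also have "\<dots> = b * (\<Sum>i\<in>UNIV. c i * y $ i)"
    unfolding assms by (simp add: mult.left_commute[of _ b] flip: sum_distrib_left)
  finally show ?thesis by simp
qed

text \<open>Divisibility in both directions forces the multipliers to agree. Hence dilates of the
  primitive vectors by different positive integers are disjoint.\<close>

lemma primitive_decomposition_unique:
  fixes x y :: "int ^ 'n"
  assumes "primitive x" "primitive y" "int a *s x = int b *s y" "0 < a"
  shows "a = b" "x = y"
proof -
  have "int b dvd int a" "int a dvd int b"
    using primitive_scale_dvd assms by metis+
  then show "a = b" by (auto intro: dvd_antisym)
  then show "x = y" using assms by (auto simp: vec_eq_iff)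
qed

text \<open>The Bezout functional of \<open>f\<close>, multiplied by the vector \<open>g\<close>, is
  such a homomorphism.\<close>

lemma primitive_hom_exists:
  fixes f :: "int ^ 'n" and g :: "int ^ 'k"
  assumes "primitive f"
  shows "\<exists>\<phi>\<in>hom free_abelian free_abelian. \<phi> f = g"
proof -
  obtain c where "(\<Sum>i\<in>UNIV. c i * f $ i) = 1" using assms by (auto simp: primitive_def)
  then show ?thesis
    by (intro bexI[of _ "\<lambda>x. (\<Sum>i\<in>UNIV. c i * x $ i) *s g"])
       (auto simp: hom_def free_abelian_def vec_eq_iff distrib_left distrib_right sum.distrib)
qed

lemma hom_free_abelian_scale:
  assumes "\<phi> \<in> hom (free_abelian :: (int ^ 'n) monoid) (free_abelian :: (int ^ 'k) monoid)"
  shows "\<phi> (int d *s x) = int d *s \<phi> x"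
proof -
  have add: "\<phi> (x + y) = \<phi> x + \<phi> y" for x y
    using assms by (auto simp: hom_def free_abelian_def)
  have "\<phi> 0 = 0" using add[of 0 0] by simp
  then show ?thesis
  proof (induction d)
    case (Suc d)
    have "int (Suc d) *s x = x + int d *s x" "int (Suc d) *s \<phi> x = \<phi> x + int d *s \<phi> x"
      by (simp_all add: vec_eq_iff algebra_simps)
    then show ?case using Suc by (simp add: add)
  qed (simp add: vec_eq_iff)
qed

text \<open>If \<open>f\<close> is \<open>d\<close> times a vector, then so is its image
  \<open>g\<close>, and primitivity of \<open>g\<close> forces \<open>d\<close> to be 1. The zero
  vector maps to zero, which is not primitive.\<close>

lemma primitive_hom_preimage:
  fixes f :: "int ^ 'n" and g :: "int ^ 'k"
  assumes \<phi>: "\<phi> \<in> hom free_abelian free_abelian" "\<phi> f = g" and g: "primitive g"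
  shows "primitive f"
proof (cases "f = 0")
  case True
  have "\<phi> (int 0 *s f) = int 0 *s \<phi> f" by (rule hom_free_abelian_scale[OF \<phi>(1)])
  then have "g = 0" using True \<phi>(2) by simp
  then show ?thesis using g not_primitive_0 by blast
next
  case False
  then obtain d y where d: "0 < d" "primitive y" "f = int d *s y"
    by (rule primitive_decomposition)
  have "1 *s g = int d *s \<phi> y"
    using \<phi> d hom_free_abelian_scale[OF \<phi>(1)] by (metis vector_smult_lid)
  then have "int d dvd 1" using g primitive_scale_dvd by blast
  then show ?thesis using d by simp
qed

section \<open>Lattice points and primitive points in the balls of a norm\<close>

lemma finite_int_box: "finite {x :: int ^ 'n. \<forall>i. \<bar>x $ i\<bar> \<le> m}"
proof (rule finite_subset)
  show "{x :: int ^ 'n. \<forall>i. \<bar>x $ i\<bar> \<le> m} \<subseteq> vec_lambda ` (UNIV \<rightarrow>\<^sub>E {-m..m})"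
  proof
    fix x :: "int ^ 'n" assume "x \<in> {x. \<forall>i. \<bar>x $ i\<bar> \<le> m}"
    then have "vec_nth x \<in> UNIV \<rightarrow>\<^sub>E {-m..m}" by (auto simp: abs_le_iff minus_le_iff)
    then show "x \<in> vec_lambda ` (UNIV \<rightarrow>\<^sub>E {-m..m})"
      by (intro image_eqI[of _ _ "vec_nth x"]) auto
  qed
  show "finite (vec_lambda ` (UNIV \<rightarrow>\<^sub>E {-m..m} :: ('n \<Rightarrow> int) set) :: (int ^ 'n) set)"
    by (intro finite_imageI finite_PiE) auto
qed

definition real_vec :: "int ^ 'n \<Rightarrow> real ^ 'n" where
  "real_vec x = (\<chi> i. real_of_int (x $ i))"

lemma real_vec_nth [simp]: "real_vec x $ i = real_of_int (x $ i)"
  by (simp add: real_vec_def)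

lemma real_vec_scale: "real_vec (int d *s x) = real d *\<^sub>R real_vec x"
  by (simp add: vec_eq_iff)

text \<open>Treats all l_p norms at once. Domination of the coordinates takes the place of
  definiteness: it makes balls finite and gives nonzero lattice points norm at least 1.\<close>

locale lattice_norm =
  fixes N :: "real ^ 'n \<Rightarrow> real"
  assumes triangle: "N (x + y) \<le> N x + N y"
    and scale: "N (c *\<^sub>R x) = \<bar>c\<bar> * N x"
    and component_le: "\<bar>x $ i\<bar> \<le> N x"
begin

definition lattice_ball :: "real \<Rightarrow> (int ^ 'n) set" where
  "lattice_ball s = {x. N (real_vec x) \<le> s}"

definition primitive_ball :: "real \<Rightarrow> (int ^ 'n) set" where
  "primitive_ball s = {x. primitive x \<and> N (real_vec x) \<le> s}"

lemma zero [simp]: "N 0 = 0"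
  using scale[of 0 0] by simp

lemma nonneg: "0 \<le> N x"
  \<comment> \<open>Any index serves here; \<open>undefined\<close> merely names one.\<close>
  using component_le[of x undefined] by linarith

lemma diff_triangle: "N x - N y \<le> N (x - y)"
  using triangle[of "x - y" y] by simp

lemma finite_lattice_ball: "finite (lattice_ball s)"
proof (rule finite_subset[OF _ finite_int_box[of "\<lceil>s\<rceil>"]])
  show "lattice_ball s \<subseteq> {x. \<forall>i. \<bar>x $ i\<bar> \<le> \<lceil>s\<rceil>}"
  proof (clarsimp simp: lattice_ball_def)
    fix x :: "int ^ 'n" and i assume "N (real_vec x) \<le> s"
    then have "real_of_int \<bar>x $ i\<bar> \<le> s" using component_le[of "real_vec x" i] by simp
    then show "\<bar>x $ i\<bar> \<le> \<lceil>s\<rceil>" by linarith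
  qed
qed

lemma primitive_ball_subset: "primitive_ball s \<subseteq> lattice_ball s"
  by (auto simp: primitive_ball_def lattice_ball_def)

lemma finite_primitive_ball: "finite (primitive_ball s)"
  using primitive_ball_subset finite_lattice_ball by (rule finite_subset)

lemma lattice_point_ge_1:
  assumes "x \<noteq> 0"
  shows "1 \<le> N (real_vec x)"
proof -
  obtain i where "x $ i \<noteq> 0" using assms by (auto simp: vec_eq_iff)
  then have "1 \<le> \<bar>x $ i\<bar>" by linarith
  then have "1 \<le> \<bar>real_vec x $ i\<bar>" by simp
  then show ?thesis using component_le[of "real_vec x" i] by linarith
qed

lemma primitive_ball_empty: "s < 1 \<Longrightarrow> primitive_ball s = {}"
  using lattice_point_ge_1 not_primitive_0 unfolding primitive_ball_def
  by (metis (mono_tags, lifting) Collect_empty_eq not_less order_trans)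

lemma lattice_ball_small:
  assumes "0 < s" "s < 1"
  shows "lattice_ball s = {0}"
proof -
  have "real_vec (0 :: int ^ 'n) = 0" by (simp add: vec_eq_iff)
  then show ?thesis
    using assms lattice_point_ge_1 by (fastforce simp: lattice_ball_def)
qed

lemma zero_in_lattice_ball: "0 < s \<Longrightarrow> 0 \<in> lattice_ball s"
proof -
  have "real_vec (0 :: int ^ 'n) = 0" by (simp add: vec_eq_iff)
  then show "0 < s \<Longrightarrow> 0 \<in> lattice_ball s" by (simp add: lattice_ball_def)
qed

text \<open>Every nonzero point of the ball is k + 1 times a primitive point of the ball of radius
  s/(k + 1), for exactly one k. The subtracted 1 is the origin.\<close>

lemma primitive_ball_sums:
  assumes s: "0 < s"
  shows "(\<lambda>k. real (card (primitive_ball (s / real (Suc k))))) sums (real (card (lattice_ball s)) - 1)"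
proof -
  \<comment> \<open>From \<open>m\<close> on the radius \<open>s / real (Suc k)\<close> is below 1,
    so no primitive points remain and the series is a finite sum.\<close>
  obtain m where m: "s < real m" using reals_Archimedean2 by blast
  define I where "I k = (\<lambda>y. int (Suc k) *s y) ` primitive_ball (s / real (Suc k))" for k
  have inj: "inj_on (\<lambda>y :: int ^ 'n. int (Suc k) *s y) X" for k X
    by (auto simp: inj_on_def vec_eq_iff simp del: of_nat_Suc)
  have mem: "N (real_vec (int (Suc k) *s y)) \<le> s \<longleftrightarrow> N (real_vec y) \<le> s / real (Suc k)" for k y
    by (simp add: real_vec_scale scale pos_le_divide_eq mult.commute del: of_nat_Suc)
  have empty: "primitive_ball (s / real (Suc k)) = {}" if "m \<le> k" for k
    using that m by (intro primitive_ball_empty) (simp add: divide_less_eq)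
  have "lattice_ball s - {0} = (\<Union>k<m. I k)"
  proof (intro equalityI subsetI)
    fix x assume x: "x \<in> lattice_ball s - {0}"
    then obtain d y where d: "0 < d" "primitive y" "x = int d *s y"
      using primitive_decomposition by blast
    then obtain k where k: "d = Suc k" by (cases d) auto
    have y: "y \<in> primitive_ball (s / real (Suc k))"
      using x d mem[of k y] by (simp add: primitive_ball_def lattice_ball_def k del: of_nat_Suc)
    then have "k < m" using empty[of k] by (cases "k < m") auto
    then show "x \<in> (\<Union>k<m. I k)" using d k y by (auto simp: I_def)
  next
    fix x assume "x \<in> (\<Union>k<m. I k)"
    then obtain k y where y: "y \<in> primitive_ball (s / real (Suc k))" "x = int (Suc k) *s y"
      by (auto simp: I_def)
    then have "x \<in> lattice_ball s"
      using mem[of k y] by (simp add: primitive_ball_def lattice_ball_def del: of_nat_Suc)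
    moreover have "x \<noteq> 0"
    proof
      assume "x = 0"
      then have "y = 0" using y by (simp add: vec_eq_iff del: of_nat_Suc)
      then show False using y not_primitive_0 by (auto simp: primitive_ball_def)
    qed
    ultimately show "x \<in> lattice_ball s - {0}" by blast
  qed
  then have "card (lattice_ball s) - 1 = card (\<Union>k<m. I k)"
    using zero_in_lattice_ball[OF s] by (metis card_Diff_singleton)
  also have "\<dots> = (\<Sum>k<m. card (I k))"
  proof (rule card_UN_disjoint)
    show "\<forall>i\<in>{..<m}. \<forall>j\<in>{..<m}. i \<noteq> j \<longrightarrow> I i \<inter> I j = {}"
    proof (intro ballI impI, rule ccontr)
      fix i j assume "i \<noteq> j" "I i \<inter> I j \<noteq> {}"
      then obtain y z where "y \<in> primitive_ball (s / real (Suc i))"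
        "z \<in> primitive_ball (s / real (Suc j))" "int (Suc i) *s y = int (Suc j) *s z"
        unfolding I_def by blast
      then have "int (Suc i) *s y = int (Suc j) *s z" "primitive y" "primitive z"
        by (simp_all only: primitive_ball_def mem_Collect_eq)
      then show False using primitive_decomposition_unique(1)[of y z "Suc i" "Suc j"] \<open>i \<noteq> j\<close> by simp
    qed
  qed (auto simp: I_def finite_primitive_ball)
  also have "\<dots> = (\<Sum>k<m. card (primitive_ball (s / real (Suc k))))"
    unfolding I_def by (intro sum.cong card_image inj refl)
  \<comment> \<open>The origin is counted, so the subtraction of natural numbers above is not
    truncated.\<close>
  moreover have "card (lattice_ball s) \<ge> 1"
    using zero_in_lattice_ball[OF s] finite_lattice_ball
    by (metis One_nat_def Suc_leI card_gt_0_iff empty_iff)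
  ultimately have "real (card (lattice_ball s)) - 1
      = (\<Sum>k<m. real (card (primitive_ball (s / real (Suc k)))))"
    by (metis of_nat_1 of_nat_diff of_nat_sum)
  also have "(\<lambda>k. real (card (primitive_ball (s / real (Suc k))))) sums \<dots>"
    using empty by (intro sums_finite) (auto simp: not_less)
  finally show ?thesis .
qed

lemma sum_le: "N (\<Sum>i\<in>A. f i) \<le> (\<Sum>i\<in>A. N (f i))"
proof (induction A rule: infinite_finite_induct)
  case (insert i A)
  then show ?case using triangle[of "f i" "\<Sum>i\<in>A. f i"] by simp
qed auto

text \<open>\<open>D\<close> bounds the error made on replacing a point of a unit cell by the
  lattice point at its corner.\<close>

lemma bounded_on_cube: "\<exists>D\<ge>1. \<forall>v. (\<forall>i. \<bar>v $ i\<bar> \<le> 1) \<longrightarrow> N v \<le> D"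
proof (intro exI conjI allI impI)
  let ?D = "1 + (\<Sum>i\<in>UNIV. N (axis i 1))"
  show "1 \<le> ?D" by (simp add: sum_nonneg nonneg)
  fix v :: "real ^ 'n" assume v: "\<forall>i. \<bar>v $ i\<bar> \<le> 1"
  have "N v = N (\<Sum>i\<in>UNIV. v $ i *\<^sub>R axis i 1)"
    using basis_expansion[of v] by (simp add: scalar_mult_eq_scaleR)
  also have "\<dots> \<le> (\<Sum>i\<in>UNIV. \<bar>v $ i\<bar> * N (axis i 1))"
    using sum_le[of "\<lambda>i. v $ i *\<^sub>R axis i 1" UNIV] by (simp add: scale)
  also have "\<dots> \<le> (\<Sum>i\<in>UNIV. 1 * N (axis i 1))"
    using v by (intro sum_mono mult_right_mono nonneg) auto
  finally show "N v \<le> ?D" by simp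
qed

section \<open>Counting lattice points by volume\<close>

definition volume :: real where
  "volume = measure lebesgue {v. N v \<le> 1}"

lemma lmeasurable_ball: "{v. N v \<le> r} \<in> lmeasurable"
proof (rule measurable_convex)
  show "convex {v. N v \<le> r}"
  proof (rule convexI, clarsimp)
    fix x y and u v :: real
    assume *: "N x \<le> r" "N y \<le> r" "0 \<le> u" "0 \<le> v" "u + v = 1"
    have "N (u *\<^sub>R x + v *\<^sub>R y) \<le> u * N x + v * N y"
      using triangle[of "u *\<^sub>R x" "v *\<^sub>R y"] * by (simp add: scale)
    also have "\<dots> \<le> u * r + v * r" using * by (intro add_mono mult_left_mono) auto
    finally show "N (u *\<^sub>R x + v *\<^sub>R y) \<le> r" using * by (simp flip: distrib_right)
  qed
  show "bounded {v. N v \<le> r}"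
  proof (rule bounded_subset[OF bounded_cbox[of "\<chi> i. - r" "\<chi> i. r"]], clarsimp simp: mem_box_cart)
    fix x i assume "N x \<le> r"
    then show "- r \<le> x $ i \<and> x $ i \<le> r" using component_le[of x i] by linarith
  qed
qed

lemma measure_ball:
  assumes "0 < r"
  shows "measure lebesgue {v. N v \<le> r} = r ^ CARD('n) * volume"
proof -
  have "{v. N v \<le> r} = (\<lambda>v. r *\<^sub>R v + 0) ` {v. N v \<le> 1}"
  proof (intro equalityI subsetI)
    fix v assume "v \<in> {v. N v \<le> r}"
    then show "v \<in> (\<lambda>v. r *\<^sub>R v + 0) ` {v. N v \<le> 1}"
      using assms by (intro image_eqI[of _ _ "(1 / r) *\<^sub>R v"]) (auto simp: scale divide_le_eq)
  qed (use assms in \<open>auto simp: scale mult_le_cancel_left1\<close>)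
  then show ?thesis
    using measure_lebesgue_affine[of r 0 "{v. N v \<le> 1}"] assms by (simp add: volume_def)
qed

text \<open>A cube of side \<open>1 / D\<close> fits into the unit ball. Positivity allows the
  volume to be cancelled in the density.\<close>

lemma volume_pos: "0 < volume"
proof -
  obtain D where D: "1 \<le> D" "\<And>v. (\<forall>i. \<bar>v $ i\<bar> \<le> 1) \<Longrightarrow> N v \<le> D"
    using bounded_on_cube by blast
  let ?Q = "cbox 0 (\<chi> i. 1 / D) :: (real ^ 'n) set"
  have "?Q \<noteq> {}" using D(1) by (simp add: interval_ne_empty_cart)
  then have "0 < measure lebesgue ?Q"
    using D(1) by (simp add: content_cbox_cart)
  also have "\<dots> \<le> volume"
    unfolding volume_def
  proof (rule measure_mono_fmeasurable)
    show "?Q \<subseteq> {v. N v \<le> 1}"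
    proof
      fix v assume "v \<in> ?Q"
      then have "N (D *\<^sub>R v) \<le> D"
        using D(1) by (intro D(2)) (auto simp: mem_box_cart abs_mult field_simps)
      then show "v \<in> {v. N v \<le> 1}" using D(1) by (simp add: scale)
    qed
  qed (auto simp: lmeasurable_ball)
  finally show ?thesis .
qed

text \<open>The unit cells at the lattice points of a ball lie in a slightly larger ball and cover a
  slightly smaller one.\<close>

lemma card_lattice_ball_bounds:
  "\<exists>D\<ge>1. (\<forall>s>0. real (card (lattice_ball s)) \<le> (s + D) ^ CARD('n) * volume)
    \<and> (\<forall>s>D. (s - D) ^ CARD('n) * volume \<le> real (card (lattice_ball s)))"
proof -
  obtain D where D: "1 \<le> D" "\<And>v. (\<forall>i. \<bar>v $ i\<bar> \<le> 1) \<Longrightarrow> N v \<le> D"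
    using bounded_on_cube by blast
  \<comment> \<open>Open cells are pairwise disjoint and serve the upper bound; closed cells cover
    the space and serve the lower one. Both have measure 1.\<close>
  let ?open = "\<lambda>x. box (real_vec x) (real_vec x + 1)"
  let ?closed = "\<lambda>x. cbox (real_vec x) (real_vec x + 1)"
  have ne: "cbox z (z + 1) \<noteq> {}" for z :: "real ^ 'n"
    by (simp add: interval_ne_empty_cart)
  have closed: "measure lebesgue (cbox z (z + 1)) = 1" for z :: "real ^ 'n"
    using ne by (simp add: content_cbox_cart)
  have "measure lborel (box z (z + 1)) = measure lborel (cbox z (z + 1))" for z :: "real ^ 'n"
    unfolding measure_lborel_box_eq measure_lborel_cbox_eq ..
  then have open1: "measure lebesgue (box z (z + 1)) = 1" for z :: "real ^ 'n"
    using closed[of z] by simp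
  show ?thesis
  proof (intro exI[of _ D] conjI allI impI D(1))
    fix s :: real assume s: "0 < s"
    have disj: "pairwise (\<lambda>x y. disjnt (?open x) (?open y)) (lattice_ball s)"
    proof (rule pairwiseI)
      fix x y :: "int ^ 'n" assume "x \<noteq> y"
      then obtain i where "x $ i \<noteq> y $ i" by (auto simp: vec_eq_iff)
      have False if "v \<in> ?open x" "v \<in> ?open y" for v
      proof -
        have "real_of_int (x $ i) < v $ i" "v $ i < real_of_int (x $ i) + 1"
          "real_of_int (y $ i) < v $ i" "v $ i < real_of_int (y $ i) + 1"
          using that by (auto simp: mem_box_cart)
        then have "x $ i = y $ i" by linarith
        with \<open>x $ i \<noteq> y $ i\<close> show False ..
      qed
      then show "disjnt (?open x) (?open y)" by (auto simp: disjnt_def)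
    qed
    have "real (card (lattice_ball s)) = (\<Sum>x\<in>lattice_ball s. measure lebesgue (?open x))"
      by (simp only: open1) simp
    also have "\<dots> = measure lebesgue (\<Union>x\<in>lattice_ball s. ?open x)"
      using finite_lattice_ball disj by (intro measure_UNION'[symmetric]) auto
    also have "\<dots> \<le> measure lebesgue {v. N v \<le> s + D}"
    proof (rule measure_mono_fmeasurable)
      show "(\<Union>x\<in>lattice_ball s. ?open x) \<subseteq> {v. N v \<le> s + D}"
      proof clarify
        fix x v assume x: "x \<in> lattice_ball s" and v: "v \<in> ?open x"
        have "N (v - real_vec x) \<le> D"
          using v by (intro D(2)) (smt (verit) mem_box_cart one_index vector_add_component vector_minus_component)
        then show "N v \<le> s + D"
          using diff_triangle[of v "real_vec x"] x by (simp add: lattice_ball_def)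
      qed
      show "(\<Union>x\<in>lattice_ball s. ?open x) \<in> sets lebesgue"
        by (intro sets.finite_UN finite_lattice_ball) auto
    qed (rule lmeasurable_ball)
    also have "\<dots> = (s + D) ^ CARD('n) * volume"
      using s D(1) by (intro measure_ball) auto
    finally show "real (card (lattice_ball s)) \<le> (s + D) ^ CARD('n) * volume" .
  next
    fix s :: real assume s: "D < s"
    have "(s - D) ^ CARD('n) * volume = measure lebesgue {v. N v \<le> s - D}"
      using s by (intro measure_ball[symmetric]) auto
    also have "\<dots> \<le> measure lebesgue (\<Union>x\<in>lattice_ball s. ?closed x)"
    proof (rule measure_mono_fmeasurable)
      show "{v. N v \<le> s - D} \<subseteq> (\<Union>x\<in>lattice_ball s. ?closed x)"
      proof clarify
        fix v assume v: "N v \<le> s - D"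
        \<comment> \<open>The coordinatewise floor is the corner of a closed cell containing
          \<open>v\<close>.\<close>
        define x :: "int ^ 'n" where "x = (\<chi> i. \<lfloor>v $ i\<rfloor>)"
        have fl: "real_of_int \<lfloor>t\<rfloor> \<le> t \<and> t \<le> real_of_int \<lfloor>t\<rfloor> + 1" for t :: real by linarith
        have "N (real_vec x - v) \<le> D"
          using fl by (intro D(2)) (simp add: x_def abs_le_iff algebra_simps)
        then have "N (real_vec x) \<le> s"
          using diff_triangle[of "real_vec x" v] v by simp
        moreover have "v \<in> ?closed x"
          using fl by (simp add: mem_box_cart x_def)
        ultimately show "v \<in> (\<Union>x\<in>lattice_ball s. ?closed x)"
          by (auto simp: lattice_ball_def)
      qed
      show "(\<Union>x\<in>lattice_ball s. ?closed x) \<in> lmeasurable"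
        by (intro fmeasurable.finite_UN finite_lattice_ball) auto
    qed (rule fmeasurableD[OF lmeasurable_ball])
    also have "\<dots> \<le> (\<Sum>x\<in>lattice_ball s. measure lebesgue (?closed x))"
      using finite_lattice_ball by (intro measure_UNION_le) auto
    also have "\<dots> = real (card (lattice_ball s))"
      by (simp only: closed) simp
    finally show "(s - D) ^ CARD('n) * volume \<le> real (card (lattice_ball s))" .
  qed
qed

lemma lattice_ball_asymptotics:
  "((\<lambda>s. real (card (lattice_ball s)) / s ^ CARD('n)) \<longlongrightarrow> volume) at_top"
proof -
  obtain D where D: "1 \<le> D"
    "\<And>s. 0 < s \<Longrightarrow> real (card (lattice_ball s)) \<le> (s + D) ^ CARD('n) * volume"
    "\<And>s. D < s \<Longrightarrow> (s - D) ^ CARD('n) * volume \<le> real (card (lattice_ball s))"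
    using card_lattice_ball_bounds by metis
  have lim: "((\<lambda>s. (1 + c / s) ^ CARD('n) * volume) \<longlongrightarrow> volume) at_top" for c :: real
  proof -
    have "((\<lambda>s. c / s) \<longlongrightarrow> 0) at_top"
      by (intro tendsto_divide_0[OF tendsto_const] filterlim_at_top_imp_at_infinity filterlim_ident)
    then have "((\<lambda>s. (1 + c / s) ^ CARD('n) * volume) \<longlongrightarrow> (1 + 0) ^ CARD('n) * volume) at_top"
      by (intro tendsto_intros)
    then show ?thesis by simp
  qed
  show ?thesis
  proof (rule tendsto_sandwich[OF _ _ lim[of "- D"] lim[of D]])
    show "\<forall>\<^sub>F s in at_top. (1 + - D / s) ^ CARD('n) * volume
        \<le> real (card (lattice_ball s)) / s ^ CARD('n)"
      using eventually_gt_at_top[of D]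
    proof eventually_elim
      case (elim s)
      then have s: "0 < s" using D(1) by linarith
      have "1 + - D / s = (s - D) / s" using s by (simp add: field_simps)
      then show ?case
        using D(3)[OF elim] s by (simp add: power_divide divide_right_mono)
    qed
    show "\<forall>\<^sub>F s in at_top. real (card (lattice_ball s)) / s ^ CARD('n)
        \<le> (1 + D / s) ^ CARD('n) * volume"
      using eventually_gt_at_top[of 0]
    proof eventually_elim
      case (elim s)
      have "1 + D / s = (s + D) / s" using elim by (simp add: field_simps)
      then show ?case
        using D(2)[OF elim] elim by (simp add: power_divide divide_right_mono)
    qed
  qed
qed

text \<open>A bound for all positive radii, since the recursion visits arbitrarily small s/d.
  Removing the origin is essential: near 0 it alone would outgrow any multiple of s^n.\<close>

lemma lattice_ball_growth:
  "\<exists>M. \<forall>s>0. real (card (lattice_ball s)) - 1 \<le> M * s ^ CARD('n)"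
proof -
  obtain D where D: "1 \<le> D"
    "\<And>s. 0 < s \<Longrightarrow> real (card (lattice_ball s)) \<le> (s + D) ^ CARD('n) * volume"
    "\<And>s. D < s \<Longrightarrow> (s - D) ^ CARD('n) * volume \<le> real (card (lattice_ball s))"
    using card_lattice_ball_bounds by metis
  have "real (card (lattice_ball s)) - 1 \<le> ((1 + D) ^ CARD('n) * volume) * s ^ CARD('n)"
    if s: "0 < s" for s
  proof (cases "s < 1")
    case True
    then show ?thesis using s D(1) volume_pos by (simp add: lattice_ball_small)
  next
    case False
    have "s + D \<le> (1 + D) * s"
      using False D(1) mult_left_mono[of 1 s D] by (simp add: algebra_simps)
    then have "(s + D) ^ CARD('n) * volume \<le> ((1 + D) * s) ^ CARD('n) * volume"
      using s D(1) volume_pos by (intro mult_right_mono power_mono) auto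
    then show ?thesis using D(2)[OF s] by (simp add: power_mult_distrib mult_ac)
  qed
  then show ?thesis by blast
qed

section \<open>The density of primitive vectors\<close>

text \<open>Primitive points grow like \<open>volume / z\<close> and all points like
  \<open>volume\<close>, each times s^n, so the norm disappears from the quotient.\<close>

lemma primitive_density:
  assumes n: "CARD('n) \<ge> 2"
  shows "((\<lambda>s. real (card (primitive_ball s)) / real (card (lattice_ball s)))
           \<longlongrightarrow> 1 / zeta (real CARD('n))) at_top"
proof -
  let ?n = "CARD('n)"
  define w :: "nat \<Rightarrow> real" where "w k = 1 / real (k + 2) ^ ?n" for k
  define z where "z = zeta (real ?n)"
  define a where "a s = real (card (primitive_ball s)) / s ^ ?n" for s
  define b where "b s = (real (card (lattice_ball s)) - 1) / s ^ ?n" for s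
  define u where "u s = a s - volume / z" for s
  have w: "w sums (z - 1)" using zeta_tail[OF n] unfolding w_def z_def .
  have w0: "0 \<le> w k" for k by (simp add: w_def)
  have z: "1 \<le> z" "z < 2" using zeta_nat_ge_1[OF n] zeta_nat_less_2[OF n] by (auto simp: z_def)
  \<comment> \<open>The divisor 1 contributes \<open>a s\<close> itself and is moved to the right;
    the others acquire their weights from (s/d)^n = s^n / d^n.\<close>
  have a_sums: "(\<lambda>k. w k * a (s / real (k + 2))) sums (b s - a s)" if "0 < s" for s
  proof -
    have "(\<lambda>k. real (card (primitive_ball (s / real (Suc k)))) / s ^ ?n) sums b s"
      unfolding b_def using primitive_ball_sums[OF that] by (rule sums_divide)
    then have "(\<lambda>k. real (card (primitive_ball (s / real (Suc (k + 1))))) / s ^ ?n) sums (b s - a s)"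
      by (auto dest: sums_split_initial_segment[where n = 1] simp: a_def)
    moreover have "real (card (primitive_ball (s / real (Suc (k + 1))))) / s ^ ?n
        = w k * a (s / real (k + 2))" for k
      using that by (simp add: w_def a_def power_divide del: of_nat_Suc of_nat_add)
    ultimately show ?thesis by simp
  qed
  have u_sums: "(\<lambda>k. w k * u (s / real (k + 2))) sums (b s - volume - u s)" if "0 < s" for s
  proof -
    have "(\<lambda>k. w k * a (s / real (k + 2)) - w k * (volume / z))
        sums (b s - a s - (z - 1) * (volume / z))"
      by (intro sums_diff a_sums that sums_mult2 w)
    \<comment> \<open>\<open>volume / z\<close> is the fixed point of the limiting recursion: weight
      1 from d = 1 and \<open>z - 1\<close> from d \<ge> 2 together give
      \<open>volume\<close>.\<close>
    moreover have "b s - a s - (z - 1) * (volume / z) = b s - volume - u s"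
      using z by (simp add: u_def field_simps)
    ultimately show ?thesis by (simp only: u_def right_diff_distrib)
  qed
  obtain M where M: "\<And>s. 0 < s \<Longrightarrow> real (card (lattice_ball s)) - 1 \<le> M * s ^ ?n"
    using lattice_ball_growth by blast
  \<comment> \<open>From 0 \<le> a \<le> b \<le> \<open>M\<close>, where a \<le> b because the
    remaining terms of the recursion are nonnegative.\<close>
  have u_bound: "\<bar>u s\<bar> \<le> M + volume / z" if "0 < s" for s
  proof -
    have a0: "0 \<le> a t" if "0 < t" for t using that by (simp add: a_def)
    have "0 \<le> w k * a (s / real (k + 2))" for k
      using w0 that by (intro mult_nonneg_nonneg a0) auto
    then have "0 \<le> b s - a s" using sums_le[OF _ sums_zero a_sums[OF that]] by blast
    moreover have "0 \<le> a s" using that by (rule a0)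
    moreover have "b s \<le> M" using M[OF that] that by (simp add: b_def divide_le_eq)
    moreover have "0 < volume / z" using volume_pos z by simp
    ultimately show ?thesis by (simp add: u_def)
  qed
  have b_lim: "(b \<longlongrightarrow> volume) at_top"
  proof -
    have "((\<lambda>s :: real. 1 / s ^ ?n) \<longlongrightarrow> 0) at_top"
      by (intro tendsto_divide_0[OF tendsto_const] filterlim_at_top_imp_at_infinity
          filterlim_pow_at_top filterlim_ident) simp
    then have "((\<lambda>s. real (card (lattice_ball s)) / s ^ ?n - 1 / s ^ ?n) \<longlongrightarrow> volume - 0) at_top"
      by (intro tendsto_diff lattice_ball_asymptotics)
    then show ?thesis by (simp add: b_def[abs_def] diff_divide_distrib)
  qed
  have "(u \<longlongrightarrow> 0) at_top"
  proof (rule tendsto_0_of_contraction[of w _ _ "\<lambda>s. \<bar>b s - volume\<bar>"])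
    show "summable w" "suminf w < 1" using w z by (auto simp: sums_iff)
    show "((\<lambda>s. \<bar>b s - volume\<bar>) \<longlongrightarrow> 0) at_top"
      using b_lim by (intro tendsto_rabs_zero) (simp add: LIM_zero)
    fix s :: real assume s: "0 < s"
    have summ: "summable (\<lambda>k. w k * \<bar>u (s / real (k + 2))\<bar>)"
    proof (rule summable_comparison_test)
      show "\<exists>N. \<forall>k\<ge>N. norm (w k * \<bar>u (s / real (k + 2))\<bar>) \<le> w k * (M + volume / z)"
        using w0 u_bound s by (auto simp: abs_mult intro!: exI[of _ 0] mult_left_mono)
      show "summable (\<lambda>k. w k * (M + volume / z))"
        using w by (intro summable_mult2) (simp add: sums_iff)
    qed
    have "\<bar>b s - volume - u s\<bar> \<le> (\<Sum>k. w k * \<bar>u (s / real (k + 2))\<bar>)"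
      using summable_rabs[of "\<lambda>k. w k * u (s / real (k + 2))"] u_sums[OF s] w0 summ
      by (simp add: abs_mult sums_iff)
    then show "\<bar>u s\<bar> \<le> \<bar>b s - volume\<bar> + (\<Sum>k. w k * \<bar>u (s / real (k + 2))\<bar>)"
      by linarith
  qed (use w0 u_bound in auto)
  then have "((\<lambda>s. u s + volume / z) \<longlongrightarrow> 0 + volume / z) at_top"
    by (intro tendsto_intros)
  then have "(a \<longlongrightarrow> volume / z) at_top" by (simp add: u_def[abs_def])
  then have "((\<lambda>s. a s / (real (card (lattice_ball s)) / s ^ ?n)) \<longlongrightarrow> volume / z / volume) at_top"
    using volume_pos by (intro tendsto_divide lattice_ball_asymptotics) auto
  also have "volume / z / volume = 1 / z" using volume_pos by simp
  finally show ?thesis unfolding z_def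
  proof (rule Lim_transform_eventually)
    show "\<forall>\<^sub>F s in at_top. a s / (real (card (lattice_ball s)) / s ^ ?n)
        = real (card (primitive_ball s)) / real (card (lattice_ball s))"
      using eventually_gt_at_top[of 0] by eventually_elim (simp add: a_def)
  qed
qed

end

section \<open>The l_p norms satisfy the norm axioms\<close>

text \<open>For positive arguments this is convexity of the power function. If an argument is 0, it
  reduces to w^q \<le> w for a weight w in [0,1].\<close>

lemma powr_weighted_mean_le:
  fixes x y u v q :: real
  assumes "1 \<le> q" "0 \<le> x" "0 \<le> y" "0 \<le> u" "0 \<le> v" "u + v = 1"
  shows "(u * x + v * y) powr q \<le> u * x powr q + v * y powr q"
proof -
  have shrink: "(w * a) powr q \<le> w * a powr q" if "0 \<le> w" "w \<le> 1" "0 \<le> a" for w a :: real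
  proof -
    have "w powr q \<le> w" using powr_mono'[of 1 q w] assms(1) that by simp
    then show ?thesis using that by (simp add: powr_mult mult_right_mono)
  qed
  consider "x = 0" | "y = 0" | "0 < x" "0 < y" using assms by linarith
  then show ?thesis
  proof cases
    case 3
    then have "((1 - v) * x + v * y) powr q \<le> (1 - v) * x powr q + v * y powr q"
      using convex_onD[OF powr_convex[OF assms(1)], of v x y] assms by simp
    moreover have "1 - v = u" using assms(6) by simp
    ultimately show ?thesis by (simp only:)
  qed (use assms shrink in auto)
qed

lemma lattice_norm_infnorm: "lattice_norm (infnorm :: real ^ 'n \<Rightarrow> real)"
  by unfold_locales (simp_all add: infnorm_triangle infnorm_mul component_le_infnorm_cart)

text \<open>The main point is Minkowski's inequality, obtained from convexity of the
  \<open>q\<close>-th power, coordinate by coordinate, after normalising both vectors.\<close>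

lemma lattice_norm_lp_finite:
  assumes q: "1 \<le> q"
  shows "lattice_norm (\<lambda>x :: real ^ 'n. (\<Sum>i\<in>UNIV. \<bar>x $ i\<bar> powr q) powr (1 / q))"
proof -
  define S where "S x = (\<Sum>i\<in>UNIV. \<bar>x $ i\<bar> powr q)" for x :: "real ^ 'n"
  define N where "N x = S x powr (1 / q)" for x
  have S_nonneg: "0 \<le> S x" for x by (simp add: S_def sum_nonneg)
  have N_nonneg: "0 \<le> N x" for x by (simp add: N_def)
  have powr_root: "(a powr q) powr (1 / q) = a" if "0 \<le> a" for a :: real
    using q that by (simp add: powr_powr)
  have S_eq: "S x = N x powr q" for x
    using q S_nonneg[of x] by (simp add: N_def powr_powr)
  have component: "\<bar>x $ i\<bar> \<le> N x" for x i
  proof -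
    have "\<bar>x $ i\<bar> powr q \<le> S x"
      unfolding S_def by (rule member_le_sum) auto
    then have "(\<bar>x $ i\<bar> powr q) powr (1 / q) \<le> N x"
      unfolding N_def using q by (intro powr_mono2) auto
    then show ?thesis by (simp add: powr_root)
  qed
  have scale: "N (c *\<^sub>R x) = \<bar>c\<bar> * N x" for c x
  proof -
    have "S (c *\<^sub>R x) = \<bar>c\<bar> powr q * S x"
      by (simp add: S_def abs_mult powr_mult sum_distrib_left)
    then show ?thesis using S_nonneg by (simp add: N_def powr_mult powr_root)
  qed
  have triangle: "N (x + y) \<le> N x + N y" for x y
  proof -
    define a b where "a = N x" and "b = N y"
    have zero: "z = 0" if "N z = 0" for z
      using component[of z] that by (simp add: vec_eq_iff)
    \<comment> \<open>Vectors of norm 0 are set aside so that the others can be normalised.\<close>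
    consider "x = 0" | "y = 0" | "0 < a" "0 < b"
      using zero[of x] zero[of y] N_nonneg[of x] N_nonneg[of y] by (auto simp: a_def b_def less_le)
    then show ?thesis
    proof cases
      case 3
      \<comment> \<open>\<open>(x + y) / (a + b)\<close> is a convex combination of the unit vectors \<open>x / a\<close> and \<open>y / b\<close>.\<close>
      let ?u = "a / (a + b)" and ?v = "b / (a + b)"
      have le: "\<bar>(x + y) $ i\<bar> powr q \<le> (a + b) powr q
          * (?u * (\<bar>x $ i\<bar> powr q / a powr q) + ?v * (\<bar>y $ i\<bar> powr q / b powr q))" for i
      proof -
        have "\<bar>(x + y) $ i\<bar> \<le> (a + b) * (?u * (\<bar>x $ i\<bar> / a) + ?v * (\<bar>y $ i\<bar> / b))"
          using 3 by (simp add: distrib_left)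
        then have "\<bar>(x + y) $ i\<bar> powr q
            \<le> ((a + b) * (?u * (\<bar>x $ i\<bar> / a) + ?v * (\<bar>y $ i\<bar> / b))) powr q"
          using q by (intro powr_mono2) auto
        also have "\<dots> = (a + b) powr q * (?u * (\<bar>x $ i\<bar> / a) + ?v * (\<bar>y $ i\<bar> / b)) powr q"
          by (rule powr_mult)
        also have "\<dots> \<le> (a + b) powr q
            * (?u * (\<bar>x $ i\<bar> / a) powr q + ?v * (\<bar>y $ i\<bar> / b) powr q)"
          using 3 q by (intro mult_left_mono powr_weighted_mean_le)
            (auto simp flip: add_divide_distrib)
        finally show ?thesis using 3 by (simp add: powr_divide)
      qed
      have "S (x + y) \<le> (\<Sum>i\<in>UNIV. (a + b) powr q
          * (?u * (\<bar>x $ i\<bar> powr q / a powr q) + ?v * (\<bar>y $ i\<bar> powr q / b powr q)))"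
        unfolding S_def by (intro sum_mono le)
      also have "\<dots> = (a + b) powr q * (?u * (S x / a powr q) + ?v * (S y / b powr q))"
        by (simp only: S_def sum.distrib flip: sum_distrib_left sum_divide_distrib)
      \<comment> \<open>Normalisation makes both inner quotients equal to 1, and the weights
        \<open>?u\<close> and \<open>?v\<close> add up to 1.\<close>
      also have "\<dots> = (a + b) powr q"
        using 3 by (simp add: S_eq flip: a_def b_def add_divide_distrib)
      finally have "N (x + y) \<le> ((a + b) powr q) powr (1 / q)"
        unfolding N_def using q S_nonneg by (intro powr_mono2) auto
      then show ?thesis using 3 by (simp add: powr_root flip: a_def b_def)
    qed (use N_nonneg in auto)
  qed
  show ?thesis
    using triangle scale component unfolding N_def S_def by unfold_locales
qed

lemma lattice_norm_lp_norm:
  assumes "1 \<le> p"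
  shows "lattice_norm (lp_norm p :: real ^ 'n \<Rightarrow> real)"
proof (cases p)
  case (real q)
  then show ?thesis
    using assms lattice_norm_lp_finite[of q] by (simp add: lp_norm_def[abs_def] one_ereal_def)
next
  case PInf
  then show ?thesis using lattice_norm_infnorm by (simp add: lp_norm_def[abs_def])
qed (use assms in auto)

section \<open>Bounds for the mapping ratio and passage to the limit\<close>

text \<open>The set \<open>H\<close> of realised pairs contains \<open>PM \<times> BN\<close> and
  misses \<open>(BM - PM) \<times> PN\<close>; both estimates follow by counting inside
  \<open>BM \<times> BN\<close>.\<close>

lemma mapping_ratio_bounds:
  fixes M :: "real ^ 'n \<Rightarrow> real" and N :: "real ^ 'k \<Rightarrow> real"
  assumes "lattice_norm M" "lattice_norm N" and st: "0 < s" "0 < t"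
  defines "\<delta> \<equiv> real (card (lattice_norm.primitive_ball M s)) / real (card (lattice_norm.lattice_ball M s))"
    and "\<epsilon> \<equiv> real (card (lattice_norm.primitive_ball N t)) / real (card (lattice_norm.lattice_ball N t))"
    and "r \<equiv> mapping_ratio free_abelian free_abelian (\<lambda>x. M (real_vec x)) (\<lambda>x. N (real_vec x)) s t"
  shows "\<delta> \<le> r" and "r \<le> 1 - \<epsilon> * (1 - \<delta>)"
proof -
  interpret M: lattice_norm M by fact
  interpret N: lattice_norm N by fact
  define BM PM BN PN where "BM = M.lattice_ball s" and "PM = M.primitive_ball s"
    and "BN = N.lattice_ball t" and "PN = N.primitive_ball t"
  define H where "H = {(f, g) \<in> BM \<times> BN. \<exists>\<phi>\<in>hom free_abelian free_abelian. \<phi> f = g}"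
  have fin: "finite BM" "finite BN" "finite PM" "finite PN"
    by (simp_all add: BM_def BN_def PM_def PN_def M.finite_lattice_ball N.finite_lattice_ball
        M.finite_primitive_ball N.finite_primitive_ball)
  have sub: "PM \<subseteq> BM" "PN \<subseteq> BN"
    by (simp_all add: BM_def BN_def PM_def PN_def M.primitive_ball_subset N.primitive_ball_subset)
  have "0 \<in> BM" "0 \<in> BN"
    using st by (simp_all add: BM_def BN_def M.zero_in_lattice_ball N.zero_in_lattice_ball)
  then have pos: "0 < card BM" "0 < card BN"
    using fin by (auto simp: card_gt_0_iff)
  have \<delta>: "\<delta> = real (card PM) / real (card BM)" and \<epsilon>: "\<epsilon> = real (card PN) / real (card BN)"
    by (simp_all add: \<delta>_def \<epsilon>_def BM_def BN_def PM_def PN_def)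
  have "{(f, g) \<in> carrier free_abelian \<times> carrier free_abelian.
          M (real_vec f) \<le> real s \<and> N (real_vec g) \<le> real t
          \<and> (\<exists>\<phi>\<in>hom free_abelian free_abelian. \<phi> f = g)} = H"
    "{(f, g) \<in> carrier free_abelian \<times> carrier free_abelian.
          M (real_vec f) \<le> real s \<and> N (real_vec g) \<le> real t} = BM \<times> BN"
    by (auto simp: H_def BM_def BN_def M.lattice_ball_def N.lattice_ball_def free_abelian_def)
  then have r: "r = real (card H) / (real (card BM) * real (card BN))"
    unfolding r_def mapping_ratio_def by (simp add: card_cartesian_product)
  have finH: "finite H"
    by (rule finite_subset[of _ "BM \<times> BN"]) (use fin in \<open>auto simp: H_def\<close>)
  have "PM \<times> BN \<subseteq> H"
    using sub primitive_hom_exists by (auto simp: H_def PM_def M.primitive_ball_def)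
  then have "card (PM \<times> BN) \<le> card H" by (rule card_mono[OF finH])
  then have "real (card PM) * real (card BN) \<le> real (card H)"
    by (simp add: card_cartesian_product flip: of_nat_mult)
  then show "\<delta> \<le> r"
    using pos unfolding r \<delta> by (simp add: field_simps)
  have disj: "H \<inter> ((BM - PM) \<times> PN) = {}"
    using primitive_hom_preimage
    by (fastforce simp: H_def PM_def PN_def BM_def M.primitive_ball_def M.lattice_ball_def
        N.primitive_ball_def)
  have "card H + card ((BM - PM) \<times> PN) = card (H \<union> (BM - PM) \<times> PN)"
    using finH fin disj by (intro card_Un_disjoint[symmetric]) auto
  also have "\<dots> \<le> card (BM \<times> BN)"
    using fin sub by (intro card_mono) (auto simp: H_def)
  finally have "real (card H) + real (card (BM - PM)) * real (card PN) \<le> real (card BM) * real (card BN)"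
    by (simp add: card_cartesian_product flip: of_nat_mult of_nat_add)
  moreover have "real (card (BM - PM)) = real (card BM) - real (card PM)"
    using fin sub by (simp add: card_Diff_subset of_nat_diff card_mono)
  ultimately have "real (card H)
      \<le> real (card BM) * real (card BN) - (real (card BM) - real (card PM)) * real (card PN)"
    by simp
  then have "r \<le> (real (card BM) * real (card BN) - (real (card BM) - real (card PM)) * real (card PN))
      / (real (card BM) * real (card BN))"
    unfolding r by (rule divide_right_mono) simp
  also have "\<dots> = 1 - \<epsilon> * (1 - \<delta>)"
    using pos unfolding \<delta> \<epsilon> by (simp add: field_simps)
  finally show "r \<le> 1 - \<epsilon> * (1 - \<delta>)" .
qed

theorem corollary3p4:
  fixes p :: ereal
  assumes n: "CARD('n::finite) \<ge> 2"
    and k: "CARD('k::finite) \<ge> 2"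
    and p: "1 \<le> p"
  shows "ereal (1 / zeta (real CARD('n)))
      \<le> Liminf (sequentially \<times>\<^sub>F sequentially)
          (\<lambda>(s, t). ereal (mapping_ratio (free_abelian :: (int ^ 'n) monoid)
             (free_abelian :: (int ^ 'k) monoid) (lp_length p) (lp_length p) s t))
    \<and> Limsup (sequentially \<times>\<^sub>F sequentially)
          (\<lambda>(s, t). ereal (mapping_ratio (free_abelian :: (int ^ 'n) monoid)
             (free_abelian :: (int ^ 'k) monoid) (lp_length p) (lp_length p) s t))
      \<le> ereal (1 - 1 / zeta (real CARD('k)) * (1 - 1 / zeta (real CARD('n))))"
proof -
  let ?F = "sequentially \<times>\<^sub>F sequentially :: (nat \<times> nat) filter"
  let ?M = "lp_norm p :: real ^ 'n \<Rightarrow> real" and ?N = "lp_norm p :: real ^ 'k \<Rightarrow> real"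
  let ?r = "\<lambda>(s, t). ereal (mapping_ratio (free_abelian :: (int ^ 'n) monoid)
             (free_abelian :: (int ^ 'k) monoid) (lp_length p) (lp_length p) s t)"
  interpret M: lattice_norm ?M using p by (rule lattice_norm_lp_norm)
  interpret N: lattice_norm ?N using p by (rule lattice_norm_lp_norm)
  define \<delta> where "\<delta> s = real (card (M.primitive_ball s)) / real (card (M.lattice_ball s))" for s
  define \<epsilon> where "\<epsilon> t = real (card (N.primitive_ball t)) / real (card (N.lattice_ball t))" for t
  have ne: "?F \<noteq> bot" by (simp add: prod_filter_eq_bot)
  \<comment> \<open>Each density depends on one radius only, so its one-variable limit is pulled
    back along a projection, whatever the relative growth of the two radii.\<close>
  have fst: "filterlim (\<lambda>x. real (fst x)) at_top ?F"
    by (rule filterlim_compose[OF filterlim_real_sequentially filterlim_fst])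
  have snd: "filterlim (\<lambda>x. real (snd x)) at_top ?F"
    by (rule filterlim_compose[OF filterlim_real_sequentially filterlim_snd])
  have \<delta>_lim: "((\<lambda>x. \<delta> (real (fst x))) \<longlongrightarrow> 1 / zeta (real CARD('n))) ?F"
    unfolding \<delta>_def by (rule filterlim_compose[OF M.primitive_density[OF n] fst])
  have \<epsilon>_lim: "((\<lambda>x. \<epsilon> (real (snd x))) \<longlongrightarrow> 1 / zeta (real CARD('k))) ?F"
    unfolding \<epsilon>_def by (rule filterlim_compose[OF N.primitive_density[OF k] snd])
  have ev: "\<forall>\<^sub>F x in ?F. 0 < fst x \<and> 0 < snd x"
    using eventually_prodI[OF eventually_gt_at_top[of 0] eventually_gt_at_top[of 0]] by simp
  have length: "lp_length p = (\<lambda>x. ?M (real_vec x))" "lp_length p = (\<lambda>x. ?N (real_vec x))"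
    by (simp_all add: fun_eq_iff lp_length_def real_vec_def)
  note bounds = mapping_ratio_bounds[OF M.lattice_norm_axioms N.lattice_norm_axioms]
  have low: "\<forall>\<^sub>F x in ?F. ereal (\<delta> (real (fst x))) \<le> ?r x"
    using ev
  proof eventually_elim
    case (elim x)
    then show ?case using bounds(1)[of "fst x" "snd x"] by (simp add: length \<delta>_def split_beta)
  qed
  have high: "\<forall>\<^sub>F x in ?F. ?r x \<le> ereal (1 - \<epsilon> (real (snd x)) * (1 - \<delta> (real (fst x))))"
    using ev
  proof eventually_elim
    case (elim x)
    then show ?case
      using bounds(2)[of "fst x" "snd x"] by (simp add: length \<delta>_def \<epsilon>_def split_beta)
  qed
  \<comment> \<open>Since the lower bound converges along a nontrivial filter, its
    \<open>Liminf\<close> is its limit; the upper bound is treated alike with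
    \<open>Limsup\<close>.\<close>
  have "ereal (1 / zeta (real CARD('n))) = Liminf ?F (\<lambda>x. ereal (\<delta> (real (fst x))))"
    using \<delta>_lim by (intro lim_imp_Liminf[OF ne, symmetric]) simp
  also have "\<dots> \<le> Liminf ?F ?r" by (rule Liminf_mono[OF low])
  finally have 1: "ereal (1 / zeta (real CARD('n))) \<le> Liminf ?F ?r" .
  have "Limsup ?F ?r \<le> Limsup ?F (\<lambda>x. ereal (1 - \<epsilon> (real (snd x)) * (1 - \<delta> (real (fst x)))))"
    by (rule Limsup_mono[OF high])
  also have "\<dots> = ereal (1 - 1 / zeta (real CARD('k)) * (1 - 1 / zeta (real CARD('n))))"
    by (intro lim_imp_Limsup[OF ne] tendsto_ereal tendsto_intros \<delta>_lim \<epsilon>_lim)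
  finally show ?thesis using 1 by blast
qed

end
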